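(* Let $X$ be a nonempty set, $\Sigma$ a lattice of subsets of $X$, $E$ a regularly ordered Banach space and $\boldsymbol{\mu}:\Sigma\rightarrow E_{+}$ a vector capacity. (a) If $\boldsymbol{\mu}$ is upper continuous, then the Choquet-Bochner integral is an upper continuous operator, that is, $$\lim_{n\rightarrow\infty}\left\Vert (\mathrm{CB})\int_{A}f_{n}\,\mathrm{d}\boldsymbol{\mu}-(\mathrm{CB})\int_{A}f\,\mathrm{d}\boldsymbol{\mu}\right\Vert =0$$ whenever $(f_{n})_{n}$ is a nonincreasing sequence of Choquet-Bochner integrable functions that converges pointwise to the Choquet-Bochner integrable function $f$ and $A\in\Sigma$. (b) If $\boldsymbol{\mu}$ is lower continuous, then the Choquet-Bochner integral is lower continuous in the sense that $$\lim_{n\rightarrow\infty}\left\Vert (\mathrm{CB})\int_{A}f_{n}\,\mathrm{d}\boldsymbol{\mu}-(\mathrm{CB})\int_{A}f\,\mathrm{d}\boldsymbol{\mu}\right\Vert =0$$ whenever $(f_{n})_{n}$ is a nondecreasing sequence of Choquet-Bochner integrable functions that converges pointwise to the Choquet-Bochner integrable function $f$ and $A\in\Sigma$. (c) If $\Sigma$ is an algebra and $\boldsymbol{\mu}$ is submodular, then the Choquet-Bochner integral is a submodular operator in the sense that $$(\mathrm{CB})\int_{A}\sup\{f,g\}\,\mathrm{d}\boldsymbol{\mu}+(\mathrm{CB})\int_{A}\inf\{f,g\}\,\mathrm{d}\boldsymbol{\mu}\leq(\mathrm{CB})\int_{A}f\,\mathrm{d}\boldsymbol{\mu}+(\mathrm{CB})\int_{A}g\,\mathrm{d}\boldsymbol{\mu}$$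 whenever $f$ and $g$ are Choquet-Bochner integrable and $A\in\Sigma$.
   Context: An ordered Banach space is a real Banach space $E$ with a compatible vector order whose positive cone $E_{+}=\{x\in E:x\geq0\}$ is norm-closed, proper ($E_+\cap(-E_+)=\{0\}$) and generating ($E=E_{+}-E_{+}$), and such that $0\leq x\leq y$ implies $\Vert x\Vert\leq\Vert y\Vert$. It is regularly ordered if $\Vert x\Vert=\inf\{\Vert y\Vert:y\in E,\ -y\leq x\leq y\}$ for all $x\in E$. A lattice of subsets of $X$ is a collection $\Sigma$ of subsets containing $\emptyset$ and $X$ and closed under finite unions and intersections; it is an algebra if it is also closed under complementation. A vector capacity is a set function $\boldsymbol{\mu}:\Sigma\to E_+$ with $\boldsymbol{\mu}(\emptyset)=0$ and $\boldsymbol{\mu}(A)\leq\boldsymbol{\mu}(B)$ whenever $A\subset B$ in $\Sigma$. It is submodular if $\boldsymbol{\mu}(A\cup B)+\boldsymbol{\mu}(A\cap B)\leq\boldsymbol{\mu}(A)+\boldsymbol{\mu}(B)$ for all $A,B\in\Sigma$. It is lower continuous if $\lim_n\boldsymbol{\mu}(A_n)=\boldsymbol{\mu}(\bigcup_n A_n)$ (norm limit) for every nondecreasing sequence $(A_n)$ in $\Sigma$ with $\bigcup_nA_n\in\Sigma$, and upper continuous if $\lim_n\boldsymbol{\mu}(A_n)=\boldsymbol{\mu}(\bigcap_n A_n)$ for every nonincreasing sequence $(A_n)$ in $\Sigma$ with $\bigcap_nA_n\in\Sigma$. A function $f:X\to\mathbb{R}$ is measurable if $\{x\in X:f(x)\geq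 t\}\in\Sigma$ for all $t\in\mathbb{R}$. A measurable $f$ is Choquet-Bochner integrable (with respect to $\boldsymbol{\mu}$) if for every $A\in\Sigma$ the functions $t\mapsto\boldsymbol{\mu}(\{x\in A:f(x)\geq t\})$ and $t\mapsto\boldsymbol{\mu}(\{x\in A:f(x)\geq t\})-\boldsymbol{\mu}(A)$ are Bochner integrable (Lebesgue measure) on $[0,\infty)$ and $(-\infty,0]$ respectively. Under these circumstances its Choquet-Bochner integral over $A$ is defined as $$(\mathrm{CB})\int_{A}f\,\mathrm{d}\boldsymbol{\mu}=\int_{0}^{+\infty}\boldsymbol{\mu}(\{x\in A:f(x)\geq t\})\,\mathrm{d}t+\int_{-\infty}^{0}\left[\boldsymbol{\mu}(\{x\in A:f(x)\geq t\})-\boldsymbol{\mu}(A)\right]\mathrm{d}t .$$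
   Formalization: In part (c), inf{f,g} is additionally assumed Choquet-Bochner integrable, because for nonseparable E this can fail and its integral is then undefined; integrability of sup{f,g} is proved. *)

theory Defs
  imports "HOL-Analysis.Analysis"
begin

(* Antisymmetry of the order makes the positive cone proper. *)
class ordered_banach = banach + ordered_real_vector +
  assumes closed_nonneg: "closed {x. 0 \<le> x}"
    and generating: "\<exists>y z. 0 \<le> y \<and> 0 \<le> z \<and> x = y - z"
    and norm_mono: "0 \<le> x \<Longrightarrow> x \<le> y \<Longrightarrow> norm x \<le> norm y"

(* The infimum is over a nonempty set, because the cone is generating. *)
class regularly_ordered_banach = ordered_banach +
  assumes norm_eq_Inf: "norm x = Inf {norm y | y. - y \<le> x \<and> x \<le> y}"

(* The library's has_bochner_integral is restricted to second countable target spaces and asks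
   for Borel measurability.  Here the target is an arbitrary, possibly nonseparable, normed space,
   so f is asked to be an almost everywhere limit of simple functions (strong measurability).
   Only complete measures M are used below: for these the almost everywhere limit
   makes norm (f x - s n x) measurable, so the nn_integral is the usual integral. *)
definition has_strong_bochner_integral ::
    "'a measure \<Rightarrow> ('a \<Rightarrow> 'b::real_normed_vector) \<Rightarrow> 'b \<Rightarrow> bool" where
  "has_strong_bochner_integral M f I \<longleftrightarrow>
    (\<exists>s. (\<forall>n. Bochner_Integration.simple_bochner_integrable M (s n)) \<and>
         (AE x in M. (\<lambda>n. s n x) \<longlonglongrightarrow> f x) \<and>
         (\<lambda>n. \<integral>\<^sup>+x. norm (f x - s n x) \<partial>M) \<longlonglongrightarrow> 0 \<and>
         (\<lambda>n. Bochner_Integration.simple_bochner_integral M (s n)) \<longlonglongrightarrow> I)"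

definition strong_bochner_integrable ::
    "'a measure \<Rightarrow> ('a \<Rightarrow> 'b::real_normed_vector) \<Rightarrow> bool" where
  "strong_bochner_integrable M f \<longleftrightarrow> (\<exists>I. has_strong_bochner_integral M f I)"

definition strong_bochner_integral ::
    "'a measure \<Rightarrow> ('a \<Rightarrow> 'b::real_normed_vector) \<Rightarrow> 'b" where
  "strong_bochner_integral M f = (THE I. has_strong_bochner_integral M f I)"

definition lattice_of_sets :: "'a set \<Rightarrow> 'a set set \<Rightarrow> bool" where
  "lattice_of_sets X \<Sigma> \<longleftrightarrow> \<Sigma> \<subseteq> Pow X \<and> {} \<in> \<Sigma> \<and> X \<in> \<Sigma> \<and>
    (\<forall>A\<in>\<Sigma>. \<forall>B\<in>\<Sigma>. A \<union> B \<in> \<Sigma> \<and> A \<inter> B \<in> \<Sigma>)"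

definition vector_capacity :: "'a set set \<Rightarrow> ('a set \<Rightarrow> 'e::ordered_banach) \<Rightarrow> bool" where
  "vector_capacity \<Sigma> \<mu> \<longleftrightarrow> (\<forall>A\<in>\<Sigma>. 0 \<le> \<mu> A) \<and> \<mu> {} = 0 \<and>
    (\<forall>A\<in>\<Sigma>. \<forall>B\<in>\<Sigma>. A \<subseteq> B \<longrightarrow> \<mu> A \<le> \<mu> B)"

definition submodular :: "'a set set \<Rightarrow> ('a set \<Rightarrow> 'e::ordered_banach) \<Rightarrow> bool" where
  "submodular \<Sigma> \<mu> \<longleftrightarrow> (\<forall>A\<in>\<Sigma>. \<forall>B\<in>\<Sigma>. \<mu> (A \<union> B) + \<mu> (A \<inter> B) \<le> \<mu> A + \<mu> B)"

definition lower_continuous :: "'a set set \<Rightarrow> ('a set \<Rightarrow> 'e::ordered_banach) \<Rightarrow> bool" where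
  "lower_continuous \<Sigma> \<mu> \<longleftrightarrow>
    (\<forall>A :: nat \<Rightarrow> 'a set. range A \<subseteq> \<Sigma> \<and> incseq A \<and> (\<Union>n. A n) \<in> \<Sigma>
       \<longrightarrow> (\<lambda>n. \<mu> (A n)) \<longlonglongrightarrow> \<mu> (\<Union>n. A n))"

definition upper_continuous :: "'a set set \<Rightarrow> ('a set \<Rightarrow> 'e::ordered_banach) \<Rightarrow> bool" where
  "upper_continuous \<Sigma> \<mu> \<longleftrightarrow>
    (\<forall>A :: nat \<Rightarrow> 'a set. range A \<subseteq> \<Sigma> \<and> decseq A \<and> (\<Inter>n. A n) \<in> \<Sigma>
       \<longrightarrow> (\<lambda>n. \<mu> (A n)) \<longlonglongrightarrow> \<mu> (\<Inter>n. A n))"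

definition cb_measurable :: "'a set \<Rightarrow> 'a set set \<Rightarrow> ('a \<Rightarrow> real) \<Rightarrow> bool" where
  "cb_measurable X \<Sigma> f \<longleftrightarrow> (\<forall>t. {x\<in>X. f x \<ge> t} \<in> \<Sigma>)"

definition cb_integrable ::
    "'a set \<Rightarrow> 'a set set \<Rightarrow> ('a set \<Rightarrow> 'e::ordered_banach) \<Rightarrow> ('a \<Rightarrow> real) \<Rightarrow> bool" where
  "cb_integrable X \<Sigma> \<mu> f \<longleftrightarrow> cb_measurable X \<Sigma> f \<and>
    (\<forall>A\<in>\<Sigma>. strong_bochner_integrable (lebesgue_on {0..}) (\<lambda>t. \<mu> {x\<in>A. f x \<ge> t}) \<and>
           strong_bochner_integrable (lebesgue_on {..0}) (\<lambda>t. \<mu> {x\<in>A. f x \<ge> t} - \<mu> A))"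

definition cb_integral ::
    "('a set \<Rightarrow> 'e::ordered_banach) \<Rightarrow> 'a set \<Rightarrow> ('a \<Rightarrow> real) \<Rightarrow> 'e" where
  "cb_integral \<mu> A f =
    strong_bochner_integral (lebesgue_on {0..}) (\<lambda>t. \<mu> {x\<in>A. f x \<ge> t}) +
    strong_bochner_integral (lebesgue_on {..0}) (\<lambda>t. \<mu> {x\<in>A. f x \<ge> t} - \<mu> A)"

end

(* All integrands below are monotone E-valued functions of the level t. For upper continuity,
   {f_n >= t} decreases to {g >= t}, and dominated convergence for the Bochner integral applies.
   For lower continuity, {f_n >= t} need not increase to {g >= t}, but the limit of mu {f_n >= t}
   dominates mu {g >= r} for every r > t. As t |-> mu {g >= t} is monotone and strongly measurable,
   it is right continuous almost everywhere, so the limit is mu {g >= t} for almost every t.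
   For submodularity, the pointwise inequality is that of mu; the work is in the integrability of
   t |-> mu {max f g >= t}, whose increments are dominated by those of mu {f >= t} + mu {g >= t}. *)
theory Submission
  imports Defs
begin

section \<open>Strong Bochner integrals over complete measures\<close>

lemma (in complete_measure) borel_measurable_AE_LIMSEQ:
  fixes u :: "nat \<Rightarrow> 'a \<Rightarrow> 'b::{metric_space, zero}"
  assumes u: "\<And>i. u i \<in> borel_measurable M" and lim: "AE x in M. (\<lambda>i. u i x) \<longlonglongrightarrow> v x"
  shows "v \<in> borel_measurable M"
proof -
  define N where "N = {x\<in>space M. \<not> (\<lambda>i. u i x) \<longlonglongrightarrow> v x}"
  have N: "N \<in> null_sets M"
    using lim unfolding AE_iff_null_sets N_def .
  define w where "w x = (if x \<in> N then 0 else v x)" for x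
  have w: "w \<in> borel_measurable M"
  proof (rule borel_measurable_LIMSEQ_metric)
    show "(\<lambda>x. if x \<in> N then 0 else u i x) \<in> borel_measurable M" for i
      using N u by (intro measurable_If_set) (auto simp: null_sets_def)
    show "(\<lambda>i. if x \<in> N then 0 else u i x) \<longlonglongrightarrow> w x" if "x \<in> space M" for x
      using that by (auto simp: w_def N_def)
  qed
  have AE: "AE x in M. x \<notin> N"
    using N by (rule AE_not_in)
  show ?thesis
  proof (rule measurableI)
    fix A :: "'b set" assume "A \<in> sets borel"
    with w have "w -` A \<inter> space M \<in> sets M"
      by (rule measurable_sets)
    moreover have "AE x in M. x \<in> w -` A \<inter> space M \<longleftrightarrow> x \<in> v -` A \<inter> space M"
      using AE by eventually_elim (auto simp: w_def)
    ultimately show "v -` A \<inter> space M \<in> sets M"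
      using in_sets_AE by blast
  qed simp
qed

abbreviation simple_bochner_integrable where
  "simple_bochner_integrable \<equiv> Bochner_Integration.simple_bochner_integrable"

abbreviation simple_bochner_integral where
  "simple_bochner_integral \<equiv> Bochner_Integration.simple_bochner_integral"

definition simple_L1_approx :: "'a measure \<Rightarrow> ('a \<Rightarrow> 'b::real_normed_vector) \<Rightarrow> (nat \<Rightarrow> 'a \<Rightarrow> 'b) \<Rightarrow> bool"
  where "simple_L1_approx M f s \<longleftrightarrow> (\<forall>n. simple_bochner_integrable M (s n)) \<and>
    (AE x in M. (\<lambda>n. s n x) \<longlonglongrightarrow> f x) \<and> (\<lambda>n. \<integral>\<^sup>+x. norm (f x - s n x) \<partial>M) \<longlonglongrightarrow> 0"

lemma has_strong_bochner_integral_iff_approx: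
  "has_strong_bochner_integral M f I \<longleftrightarrow>
    (\<exists>s. simple_L1_approx M f s \<and> (\<lambda>n. simple_bochner_integral M (s n)) \<longlonglongrightarrow> I)"
  by (auto simp: has_strong_bochner_integral_def simple_L1_approx_def)

lemma simple_bochner_integrable_simple_function:
  "simple_bochner_integrable M s \<Longrightarrow> simple_function M s"
  by (auto simp: simple_bochner_integrable.simps)

lemma simple_bochner_integral_zero: "simple_bochner_integral M (\<lambda>_. 0) = 0"
  by (auto simp: simple_bochner_integral_def intro!: sum.neutral)

lemma norm_simple_bochner_integral_le_nn_integral:
  assumes "simple_bochner_integrable M s"
  shows "ennreal (norm (simple_bochner_integral M s)) \<le> (\<integral>\<^sup>+x. norm (s x) \<partial>M)"
proof -
  have "simple_bochner_integrable M (\<lambda>x. norm (s x))"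
    using simple_bochner_integrable_compose2[of "\<lambda>x y. norm x", OF _ assms assms] by simp
  then show ?thesis
    using simple_bochner_integral_norm_bound[OF assms]
    by (simp add: simple_bochner_integral_eq_nn_integral[symmetric] ennreal_leI)
qed

lemma nn_integral_norm_simple_finite:
  assumes "simple_bochner_integrable M s"
  shows "(\<integral>\<^sup>+x. norm (s x) \<partial>M) < \<infinity>"
proof -
  have "simple_bochner_integrable M (\<lambda>x. norm (s x))"
    using simple_bochner_integrable_compose2[of "\<lambda>x y. norm x", OF _ assms assms] by simp
  then show ?thesis
    by (simp add: simple_bochner_integral_eq_nn_integral[symmetric])
qed

context complete_measure
begin

lemma simple_L1_approx_norm_measurable:
  assumes "simple_L1_approx M f s" and t: "simple_function M t"
  shows "(\<lambda>x. norm (f x - t x)) \<in> borel_measurable M"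
proof (rule borel_measurable_AE_LIMSEQ)
  show "(\<lambda>x. norm (s n x - t x)) \<in> borel_measurable M" for n
    using simple_function_compose2[of M "s n" t "\<lambda>x y. norm (x - y)"] assms
    by (auto simp: simple_L1_approx_def simple_bochner_integrable_simple_function
        intro!: borel_measurable_simple_function)
  have "AE x in M. (\<lambda>n. s n x) \<longlonglongrightarrow> f x"
    using assms by (auto simp: simple_L1_approx_def)
  then show "AE x in M. (\<lambda>n. norm (s n x - t x)) \<longlonglongrightarrow> norm (f x - t x)"
    by eventually_elim (intro tendsto_intros)
qed

lemma simple_L1_approx_norm_measurable0:
  assumes "simple_L1_approx M f s"
  shows "(\<lambda>x. norm (f x)) \<in> borel_measurable M"
  using simple_L1_approx_norm_measurable[OF assms, of "\<lambda>_. 0"] by simp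

lemma simple_L1_approx_combine:
  assumes f: "simple_L1_approx M f s" and g: "simple_L1_approx M g t"
    and p: "linear (\<lambda>(x, y). p x y)" and p_le: "\<And>x y. norm (p x y) \<le> norm x + norm y"
  shows "simple_L1_approx M (\<lambda>x. p (f x) (g x)) (\<lambda>n x. p (s n x) (t n x))"
proof -
  interpret p: linear "\<lambda>(x, y). p x y" by fact
  have p0: "p 0 0 = 0"
    using p.zero by (simp add: zero_prod_def)
  have p_diff: "p x y - p x' y' = p (x - x') (y - y')" for x y x' y'
    using p.diff[of "(x, y)" "(x', y')"] by simp
  have s: "simple_bochner_integrable M (s n)" and t: "simple_bochner_integrable M (t n)" for n
    using f g by (auto simp: simple_L1_approx_def)
  have lim: "(\<lambda>n. p (a n) (b n)) \<longlonglongrightarrow> p a' b'" if "a \<longlonglongrightarrow> a'" "b \<longlonglongrightarrow> b'" for a b a' b'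
  proof (rule Lim_transform_bound[where f = "\<lambda>n. p (a n) (b n) - p a' b'", THEN LIM_zero_cancel])
    show "\<forall>\<^sub>F n in sequentially. norm (p (a n) (b n) - p a' b') \<le> norm (norm (a n - a') + norm (b n - b'))"
      using p_le by (simp add: p_diff)
    show "(\<lambda>n. norm (a n - a') + norm (b n - b')) \<longlonglongrightarrow> 0"
      using tendsto_add[OF that(1)[THEN LIM_zero, THEN tendsto_norm_zero] that(2)[THEN LIM_zero, THEN tendsto_norm_zero]] by simp
  qed
  have "AE x in M. (\<lambda>n. s n x) \<longlonglongrightarrow> f x" "AE x in M. (\<lambda>n. t n x) \<longlonglongrightarrow> g x"
    using f g by (auto simp: simple_L1_approx_def)
  then have 1: "AE x in M. (\<lambda>n. p (s n x) (t n x)) \<longlonglongrightarrow> p (f x) (g x)"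
    by eventually_elim (rule lim)
  have "(\<lambda>n. \<integral>\<^sup>+x. norm (p (f x) (g x) - p (s n x) (t n x)) \<partial>M) \<longlonglongrightarrow> 0"
  proof (rule tendsto_sandwich[OF _ _ tendsto_const])
    show "\<forall>\<^sub>F n in sequentially. (\<integral>\<^sup>+x. norm (p (f x) (g x) - p (s n x) (t n x)) \<partial>M)
      \<le> (\<integral>\<^sup>+x. norm (f x - s n x) \<partial>M) + (\<integral>\<^sup>+x. norm (g x - t n x) \<partial>M)"
    proof (intro always_eventually allI)
      fix n
      have "(\<integral>\<^sup>+x. norm (p (f x) (g x) - p (s n x) (t n x)) \<partial>M)
        \<le> (\<integral>\<^sup>+x. ennreal (norm (f x - s n x)) + ennreal (norm (g x - t n x)) \<partial>M)"
        using p_le by (intro nn_integral_mono) (simp add: p_diff ennreal_plus[symmetric] ennreal_leI del: ennreal_plus)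
      also have "\<dots> = (\<integral>\<^sup>+x. norm (f x - s n x) \<partial>M) + (\<integral>\<^sup>+x. norm (g x - t n x) \<partial>M)"
        using simple_L1_approx_norm_measurable[OF f, of "s n"] simple_L1_approx_norm_measurable[OF g, of "t n"]
        by (intro nn_integral_add) (auto simp: s t simple_bochner_integrable_simple_function)
      finally show "(\<integral>\<^sup>+x. norm (p (f x) (g x) - p (s n x) (t n x)) \<partial>M) \<le> \<dots>" .
    qed
    show "(\<lambda>n. (\<integral>\<^sup>+x. norm (f x - s n x) \<partial>M) + (\<integral>\<^sup>+x. norm (g x - t n x) \<partial>M)) \<longlonglongrightarrow> 0"
      using tendsto_add[of "\<lambda>n. \<integral>\<^sup>+x. norm (f x - s n x) \<partial>M" 0 sequentially
        "\<lambda>n. \<integral>\<^sup>+x. norm (g x - t n x) \<partial>M" 0] f g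
      by (simp add: simple_L1_approx_def)
  qed simp
  with 1 show ?thesis
    using s t p0 by (auto simp: simple_L1_approx_def intro: simple_bochner_integrable_compose2)
qed

lemma simple_L1_approx_add:
  assumes "simple_L1_approx M f s" "simple_L1_approx M g t"
  shows "simple_L1_approx M (\<lambda>x. f x + g x) (\<lambda>n x. s n x + t n x)"
  using assms by (rule simple_L1_approx_combine)
    (auto simp: linear_iff norm_triangle_ineq algebra_simps)

lemma simple_L1_approx_diff:
  assumes "simple_L1_approx M f s" "simple_L1_approx M g t"
  shows "simple_L1_approx M (\<lambda>x. f x - g x) (\<lambda>n x. s n x - t n x)"
  using assms by (rule simple_L1_approx_combine)
    (auto simp: linear_iff norm_triangle_ineq4 algebra_simps)

lemma norm_simple_integral_diff_le:
  assumes f: "simple_L1_approx M f s"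
    and s: "simple_bochner_integrable M t" and t: "simple_bochner_integrable M u"
  shows "ennreal (norm (simple_bochner_integral M t - simple_bochner_integral M u)) \<le>
    (\<integral>\<^sup>+x. norm (f x - t x) \<partial>M) + (\<integral>\<^sup>+x. norm (f x - u x) \<partial>M)"
proof -
  have "ennreal (norm (simple_bochner_integral M t - simple_bochner_integral M u))
      \<le> (\<integral>\<^sup>+x. norm (t x - u x) \<partial>M)"
    using norm_simple_bochner_integral_le_nn_integral[of M "\<lambda>x. t x - u x"] s t
    by (simp add: simple_bochner_integral_diff simple_bochner_integrable_compose2)
  also have "\<dots> \<le> (\<integral>\<^sup>+x. ennreal (norm (f x - t x)) + ennreal (norm (f x - u x)) \<partial>M)"
  proof (intro nn_integral_mono)
    fix x
    have "norm (t x - u x) \<le> norm (f x - t x) + norm (f x - u x)"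
      by (metis dual_order.refl norm_diff_triangle_le norm_minus_commute)
    then show "ennreal (norm (t x - u x)) \<le> ennreal (norm (f x - t x)) + ennreal (norm (f x - u x))"
      by (metis ennreal_leI ennreal_plus norm_ge_zero)
  qed
  also have "\<dots> = (\<integral>\<^sup>+x. norm (f x - t x) \<partial>M) + (\<integral>\<^sup>+x. norm (f x - u x) \<partial>M)"
    using f s t by (intro nn_integral_add)
      (auto intro!: simple_L1_approx_norm_measurable simple_bochner_integrable_simple_function)
  finally show ?thesis .
qed

lemma simple_L1_approx_nn_integral_finite:
  assumes f: "simple_L1_approx M f s"
  shows "(\<integral>\<^sup>+x. norm (f x) \<partial>M) < \<infinity>"
proof -
  have "(\<lambda>n. \<integral>\<^sup>+x. norm (f x - s n x) \<partial>M) \<longlonglongrightarrow> 0"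
    using f by (simp add: simple_L1_approx_def)
  then have "\<forall>\<^sub>F n in sequentially. (\<integral>\<^sup>+x. norm (f x - s n x) \<partial>M) < 1"
    by (rule order_tendstoD) simp
  then obtain n where n: "(\<integral>\<^sup>+x. norm (f x - s n x) \<partial>M) < 1"
    by (auto simp: eventually_sequentially)
  have s: "simple_bochner_integrable M (s n)"
    using f by (simp add: simple_L1_approx_def)
  have "(\<integral>\<^sup>+x. norm (f x) \<partial>M) \<le> (\<integral>\<^sup>+x. ennreal (norm (f x - s n x)) + ennreal (norm (s n x)) \<partial>M)"
  proof (intro nn_integral_mono)
    fix x
    have "norm (f x) \<le> norm (f x - s n x) + norm (s n x)"
      by (metis diff_add_cancel norm_triangle_ineq)
    then show "ennreal (norm (f x)) \<le> ennreal (norm (f x - s n x)) + ennreal (norm (s n x))"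
      by (metis ennreal_leI ennreal_plus norm_ge_zero)
  qed
  also have "\<dots> = (\<integral>\<^sup>+x. norm (f x - s n x) \<partial>M) + (\<integral>\<^sup>+x. norm (s n x) \<partial>M)"
  proof (intro nn_integral_add)
    show "(\<lambda>x. ennreal (norm (f x - s n x))) \<in> borel_measurable M"
      using simple_L1_approx_norm_measurable[OF f simple_bochner_integrable_simple_function[OF s]] by simp
    show "(\<lambda>x. ennreal (norm (s n x))) \<in> borel_measurable M"
      using simple_function_compose1[OF simple_bochner_integrable_simple_function[OF s], of norm]
      by (simp add: borel_measurable_simple_function)
  qed
  also have "\<dots> < \<infinity>"
    using n nn_integral_norm_simple_finite[OF s] order.strict_trans[OF n, of top] by simp
  finally show ?thesis .
qed

lemma norm_strong_bochner_integral_le: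
  assumes "has_strong_bochner_integral M f I"
  shows "ennreal (norm I) \<le> (\<integral>\<^sup>+x. norm (f x) \<partial>M)"
proof -
  obtain s where s: "simple_L1_approx M f s" and I: "(\<lambda>n. simple_bochner_integral M (s n)) \<longlonglongrightarrow> I"
    using assms by (auto simp: has_strong_bochner_integral_iff_approx)
  have zero: "simple_bochner_integrable M (\<lambda>_. 0)"
    by (auto intro: simple_bochner_integrable.intros)
  have "ennreal (norm (simple_bochner_integral M (s n)))
      \<le> (\<integral>\<^sup>+x. norm (f x - s n x) \<partial>M) + (\<integral>\<^sup>+x. norm (f x) \<partial>M)" for n
    using norm_simple_integral_diff_le[OF s, of "s n" "\<lambda>_. 0"] s zero
    by (auto simp: simple_L1_approx_def simple_bochner_integral_zero)
  moreover have "(\<lambda>n. (\<integral>\<^sup>+x. norm (f x - s n x) \<partial>M) + (\<integral>\<^sup>+x. norm (f x) \<partial>M))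
      \<longlonglongrightarrow> 0 + (\<integral>\<^sup>+x. norm (f x) \<partial>M)"
    using s by (intro tendsto_intros) (auto simp: simple_L1_approx_def)
  ultimately show ?thesis
    using LIMSEQ_le[OF tendsto_ennrealI[OF tendsto_norm[OF I]]] by simp
qed

lemma has_strong_bochner_integral_add:
  assumes "has_strong_bochner_integral M f I" "has_strong_bochner_integral M g J"
  shows "has_strong_bochner_integral M (\<lambda>x. f x + g x) (I + J)"
proof -
  obtain s t where st: "simple_L1_approx M f s" "simple_L1_approx M g t"
    and lim: "(\<lambda>n. simple_bochner_integral M (s n)) \<longlonglongrightarrow> I" "(\<lambda>n. simple_bochner_integral M (t n)) \<longlonglongrightarrow> J"
    using assms by (auto simp: has_strong_bochner_integral_iff_approx)
  have "(\<lambda>n. simple_bochner_integral M (\<lambda>x. s n x + t n x)) \<longlonglongrightarrow> I + J"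
    using tendsto_add[OF lim] st by (simp add: simple_bochner_integral_add simple_L1_approx_def)
  with simple_L1_approx_add[OF st] show ?thesis
    by (auto simp: has_strong_bochner_integral_iff_approx)
qed

lemma has_strong_bochner_integral_diff:
  assumes "has_strong_bochner_integral M f I" "has_strong_bochner_integral M g J"
  shows "has_strong_bochner_integral M (\<lambda>x. f x - g x) (I - J)"
proof -
  obtain s t where st: "simple_L1_approx M f s" "simple_L1_approx M g t"
    and lim: "(\<lambda>n. simple_bochner_integral M (s n)) \<longlonglongrightarrow> I" "(\<lambda>n. simple_bochner_integral M (t n)) \<longlonglongrightarrow> J"
    using assms by (auto simp: has_strong_bochner_integral_iff_approx)
  have "(\<lambda>n. simple_bochner_integral M (\<lambda>x. s n x - t n x)) \<longlonglongrightarrow> I - J"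
    using tendsto_diff[OF lim] st by (simp add: simple_bochner_integral_diff simple_L1_approx_def)
  with simple_L1_approx_diff[OF st] show ?thesis
    by (auto simp: has_strong_bochner_integral_iff_approx)
qed

lemma has_strong_bochner_integral_unique:
  assumes "has_strong_bochner_integral M f I" "has_strong_bochner_integral M f J"
  shows "I = J"
  using norm_strong_bochner_integral_le[OF has_strong_bochner_integral_diff[OF assms]] by simp

lemma strong_bochner_integral_eqI:
  "has_strong_bochner_integral M f I \<Longrightarrow> strong_bochner_integral M f = I"
  unfolding strong_bochner_integral_def
  by (rule the_equality) (auto intro: has_strong_bochner_integral_unique)

lemma has_strong_bochner_integral_integral:
  "strong_bochner_integrable M f \<Longrightarrow> has_strong_bochner_integral M f (strong_bochner_integral M f)"
  by (auto simp: strong_bochner_integrable_def strong_bochner_integral_eqI)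

lemma simple_L1_approx_imp_has_integral:
  fixes f :: "'a \<Rightarrow> 'b::banach"
  assumes s: "simple_L1_approx M f s"
  obtains I where "has_strong_bochner_integral M f I" "(\<lambda>n. simple_bochner_integral M (s n)) \<longlonglongrightarrow> I"
proof -
  have "Cauchy (\<lambda>n. simple_bochner_integral M (s n))"
  proof (rule metric_CauchyI)
    fix e :: real assume "0 < e"
    then have e: "0 < ennreal (e / 2)" by simp
    have "(\<lambda>n. \<integral>\<^sup>+x. norm (f x - s n x) \<partial>M) \<longlonglongrightarrow> 0"
      using s by (simp add: simple_L1_approx_def)
    from order_tendstoD(2)[OF this e] obtain N
      where N: "(\<integral>\<^sup>+x. norm (f x - s n x) \<partial>M) < ennreal (e / 2)" if "n \<ge> N" for n
      by (auto simp: eventually_sequentially)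
    have "dist (simple_bochner_integral M (s m)) (simple_bochner_integral M (s n)) < e"
      if "m \<ge> N" "n \<ge> N" for m n
    proof -
      have "ennreal (dist (simple_bochner_integral M (s m)) (simple_bochner_integral M (s n))) <
          ennreal (e / 2) + ennreal (e / 2)"
        unfolding dist_norm
        using norm_simple_integral_diff_le[OF s, of "s m" "s n"] s
        by (intro le_less_trans[OF _ add_strict_mono[OF N[OF that(1)] N[OF that(2)]]])
          (auto simp: simple_L1_approx_def)
      also have "\<dots> = ennreal e"
        using \<open>0 < e\<close> by (simp flip: ennreal_plus)
      finally show ?thesis
        by (simp add: ennreal_less_iff)
    qed
    then show "\<exists>N. \<forall>m\<ge>N. \<forall>n\<ge>N. dist (simple_bochner_integral M (s m)) (simple_bochner_integral M (s n)) < e"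
      by blast
  qed
  then obtain I where "(\<lambda>n. simple_bochner_integral M (s n)) \<longlonglongrightarrow> I"
    using Cauchy_convergent convergent_def by blast
  with s show ?thesis
    by (intro that) (auto simp: has_strong_bochner_integral_iff_approx)
qed

text \<open>On each level set of the simple function \<open>s n\<close> the approximant of \<open>h\<close> takes the value
  of \<open>h\<close> at a point where \<open>K\<close> is almost as close to \<open>s n\<close> as possible. Even for \<open>h = K\<close> this gives
  something new, namely approximants whose values are values of \<open>h\<close>, or 0.\<close>

lemma simple_L1_approx_contraction:
  fixes K :: "'a \<Rightarrow> 'b::real_normed_vector" and h :: "'a \<Rightarrow> 'c::real_normed_vector"
  assumes s: "simple_L1_approx M K s"
    and contr: "\<And>x y. x \<in> space M \<Longrightarrow> y \<in> space M \<Longrightarrow> norm (h x - h y) \<le> norm (K x - K y)"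
    and le: "\<And>x. x \<in> space M \<Longrightarrow> norm (h x) \<le> norm (K x)"
  obtains t where "simple_L1_approx M h t" "\<And>n x. x \<in> space M \<Longrightarrow> t n x \<in> insert 0 (h ` space M)"
proof -
  have si: "simple_bochner_integrable M (s n)" for n
    using s by (simp add: simple_L1_approx_def)
  have sf: "simple_function M (s n)" for n
    using si by (rule simple_bochner_integrable_simple_function)
  define S where "S n = {x\<in>space M. s n x \<noteq> 0}" for n
  have S_fin: "emeasure M (S n) = ennreal (measure M (S n))" for n
    using si[of n] by (simp add: S_def simple_bochner_integrable.simps emeasure_eq_ennreal_measure)
  have S_meas: "S n \<in> sets M" for n
  proof -
    have "S n = space M - s n -` {0} \<inter> space M"
      by (auto simp: S_def)
    then show ?thesis
      using simple_functionD(2)[OF sf] by auto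
  qed
  define \<delta> where "\<delta> n = 1 / ((1 + real n) * (1 + measure M (S n)))" for n
  have \<delta>: "0 < \<delta> n" for n
    by (auto simp: \<delta>_def intro!: divide_pos_pos mult_pos_pos add_pos_nonneg)
  have \<delta>_le: "\<delta> n \<le> 1 / (1 + real n)" "\<delta> n * measure M (S n) \<le> 1 / (1 + real n)" for n
  proof -
    have "1 / (1 + measure M (S n)) \<le> 1" "measure M (S n) / (1 + measure M (S n)) \<le> 1"
      by (simp_all add: divide_le_eq_1 add_pos_nonneg)
    from this[THEN mult_left_mono, of "1 / (1 + real n)"]
    show "\<delta> n \<le> 1 / (1 + real n)" "\<delta> n * measure M (S n) \<le> 1 / (1 + real n)"
      by (simp_all add: \<delta>_def)
  qed
  have "\<exists>q\<in>space M. s n q = s n y \<and>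
      (\<forall>x\<in>space M. s n x = s n y \<longrightarrow> norm (K q - s n y) \<le> norm (K x - s n y) + \<delta> n)"
    if y: "y \<in> space M" for n y
  proof -
    let ?D = "(\<lambda>x. norm (K x - s n y)) ` {x\<in>space M. s n x = s n y}"
    have D: "?D \<noteq> {}" "bdd_below ?D"
      using y by (auto intro!: bdd_belowI[of _ 0])
    have "Inf ?D < Inf ?D + \<delta> n"
      using \<delta> by simp
    then obtain d where "d \<in> ?D" "d < Inf ?D + \<delta> n"
      using cInf_lessD[OF D(1)] by blast
    moreover have "Inf ?D \<le> norm (K x - s n y)" if "x \<in> space M" "s n x = s n y" for x
      using that by (intro cInf_lower D(2)) auto
    ultimately show ?thesis
      by fastforce
  qed
  then obtain q where q: "\<And>n y. y \<in> space M \<Longrightarrow> q n (s n y) \<in> space M \<and>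
      s n (q n (s n y)) = s n y \<and>
      (\<forall>x\<in>space M. s n x = s n y \<longrightarrow> norm (K (q n (s n y)) - s n y) \<le> norm (K x - s n y) + \<delta> n)"
  proof (atomize_elim, goal_cases)
    case 1
    define q where "q n v = (SOME q. q \<in> space M \<and> s n q = v \<and>
        (\<forall>x\<in>space M. s n x = v \<longrightarrow> norm (K q - v) \<le> norm (K x - v) + \<delta> n))" for n v
    have "q n (s n y) \<in> space M \<and> s n (q n (s n y)) = s n y \<and>
      (\<forall>x\<in>space M. s n x = s n y \<longrightarrow> norm (K (q n (s n y)) - s n y) \<le> norm (K x - s n y) + \<delta> n)"
      if "y \<in> space M" for n y
      unfolding q_def by (rule someI_ex) (use 1[OF that, of n] in blast)
    then show ?case by blast
  qed
  define g where "g n v = (if v = 0 then 0 else h (q n v))" for n v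
  define t where "t n x = g n (s n x)" for n x
  have ti: "simple_bochner_integrable M (t n)" for n
    unfolding t_def using simple_bochner_integrable_compose2[of "\<lambda>v _. g n v", OF _ si si]
    by (simp add: g_def)
  have bound: "norm (h x - t n x) \<le> 2 * norm (K x - s n x) + \<delta> n * indicator (S n) x"
    if x: "x \<in> space M" for n x
  proof (cases "s n x = 0")
    case True
    then show ?thesis
      using order_trans[OF le[OF x], of "2 * norm (K x)"] by (simp add: t_def g_def S_def)
  next
    case False
    have "norm (h x - t n x) \<le> norm (K x - K (q n (s n x)))"
      using False contr q x by (simp add: t_def g_def)
    also have "\<dots> \<le> norm (K x - s n x) + norm (K (q n (s n x)) - s n x)"
      using norm_triangle_ineq4[of "K x - s n x" "K (q n (s n x)) - s n x"] by simp
    also have "\<dots> \<le> norm (K x - s n x) + (norm (K x - s n x) + \<delta> n)"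
      using q[OF x, of n] x by auto
    finally show ?thesis
      using False x by (simp add: S_def)
  qed
  have null: "(\<lambda>n. 1 / (1 + real n)) \<longlonglongrightarrow> 0"
    using LIMSEQ_inverse_real_of_nat by (simp add: inverse_eq_divide add.commute)
  have "AE x in M. (\<lambda>n. s n x) \<longlonglongrightarrow> K x"
    using s by (simp add: simple_L1_approx_def)
  then have AE: "AE x in M. (\<lambda>n. t n x) \<longlonglongrightarrow> h x"
    using AE_space
  proof eventually_elim
    case (elim x)
    have "(\<lambda>n. t n x - h x) \<longlonglongrightarrow> 0"
    proof (rule Lim_null_comparison)
      have "norm (t n x - h x) \<le> 2 * norm (s n x - K x) + 1 / (1 + real n)" for n
      proof -
        have "\<delta> n * indicator (S n) x \<le> 1 / (1 + real n)"
          using \<delta>_le(1)[of n] by (cases "x \<in> S n") simp_all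
        then show ?thesis
          using bound[OF elim(2), of n] by (simp add: norm_minus_commute)
      qed
      then show "\<forall>\<^sub>F n in sequentially. norm (t n x - h x) \<le> 2 * norm (s n x - K x) + 1 / (1 + real n)"
        by simp
      show "(\<lambda>n. 2 * norm (s n x - K x) + 1 / (1 + real n)) \<longlonglongrightarrow> 0"
        using tendsto_add[OF tendsto_mult_right_zero[OF tendsto_norm_zero[OF LIM_zero[OF elim(1)]]] null, of 2]
        by simp
    qed
    then show ?case
      by (rule LIM_zero_cancel)
  qed
  have "(\<lambda>n. \<integral>\<^sup>+x. norm (h x - t n x) \<partial>M) \<longlonglongrightarrow> 0"
  proof (rule tendsto_sandwich[OF _ _ tendsto_const])
    have "(\<integral>\<^sup>+x. norm (h x - t n x) \<partial>M) \<le> 2 * (\<integral>\<^sup>+x. norm (K x - s n x) \<partial>M) + ennreal (1 / (1 + real n))" for n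
    proof -
      have [measurable]: "(\<lambda>x. norm (K x - s n x)) \<in> borel_measurable M"
        using s sf by (rule simple_L1_approx_norm_measurable)
      note S_meas[measurable]
      have "(\<integral>\<^sup>+x. norm (h x - t n x) \<partial>M)
          \<le> (\<integral>\<^sup>+x. 2 * ennreal (norm (K x - s n x)) + ennreal (\<delta> n) * indicator (S n) x \<partial>M)"
      proof (intro nn_integral_mono)
        fix x assume x: "x \<in> space M"
        have "ennreal (norm (h x - t n x)) \<le> ennreal (2 * norm (K x - s n x) + \<delta> n * indicator (S n) x)"
          using bound[OF x] by (rule ennreal_leI)
        also have "\<dots> = 2 * ennreal (norm (K x - s n x)) + ennreal (\<delta> n) * indicator (S n) x"
          using \<delta>[of n] by (simp add: ennreal_mult ennreal_indicator)
        finally show "ennreal (norm (h x - t n x)) \<le> \<dots>" .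
      qed
      also have "\<dots> = 2 * (\<integral>\<^sup>+x. norm (K x - s n x) \<partial>M) + ennreal (\<delta> n) * emeasure M (S n)"
        by (simp add: nn_integral_add nn_integral_cmult nn_integral_cmult_indicator)
      also have "ennreal (\<delta> n) * emeasure M (S n) \<le> ennreal (1 / (1 + real n))"
        unfolding S_fin using \<delta>[of n] \<delta>_le(2)[of n] by (simp add: ennreal_mult[symmetric] ennreal_leI)
      finally show ?thesis
        by (simp add: add_left_mono)
    qed
    then show "\<forall>\<^sub>F n in sequentially. (\<integral>\<^sup>+x. norm (h x - t n x) \<partial>M)
        \<le> 2 * (\<integral>\<^sup>+x. norm (K x - s n x) \<partial>M) + ennreal (1 / (1 + real n))"
      by simp
    have "(\<lambda>n. 2 * (\<integral>\<^sup>+x. norm (K x - s n x) \<partial>M)) \<longlonglongrightarrow> 2 * 0"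
      using s by (intro ennreal_tendsto_cmult) (auto simp: simple_L1_approx_def)
    from tendsto_add[OF this tendsto_ennrealI[OF null]]
    show "(\<lambda>n. 2 * (\<integral>\<^sup>+x. norm (K x - s n x) \<partial>M) + ennreal (1 / (1 + real n))) \<longlonglongrightarrow> 0"
      by simp
  qed simp
  then have "simple_L1_approx M h t"
    using ti AE by (simp add: simple_L1_approx_def)
  moreover have "t n x \<in> insert 0 (h ` space M)" if "x \<in> space M" for n x
    using q[OF that] by (auto simp: t_def g_def)
  ultimately show ?thesis
    by (rule that)
qed

lemma strong_bochner_integrable_contraction:
  fixes K :: "'a \<Rightarrow> 'b::real_normed_vector" and h :: "'a \<Rightarrow> 'c::banach"
  assumes "strong_bochner_integrable M K"
    and "\<And>x y. x \<in> space M \<Longrightarrow> y \<in> space M \<Longrightarrow> norm (h x - h y) \<le> norm (K x - K y)"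
    and "\<And>x. x \<in> space M \<Longrightarrow> norm (h x) \<le> norm (K x)"
  shows "strong_bochner_integrable M h"
proof -
  obtain s where "simple_L1_approx M K s"
    using assms(1) by (auto simp: strong_bochner_integrable_def has_strong_bochner_integral_iff_approx)
  then obtain t where "simple_L1_approx M h t"
    by (rule simple_L1_approx_contraction[OF _ assms(2,3)])
  then show ?thesis
    by (rule simple_L1_approx_imp_has_integral) (auto simp: strong_bochner_integrable_def)
qed

lemma has_strong_bochner_integral_nonneg:
  fixes f :: "'a \<Rightarrow> 'e::ordered_banach"
  assumes f: "has_strong_bochner_integral M f I" and nonneg: "\<And>x. x \<in> space M \<Longrightarrow> 0 \<le> f x"
  shows "0 \<le> I"
proof -
  obtain s where "simple_L1_approx M f s"
    using f by (auto simp: has_strong_bochner_integral_iff_approx)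
  then obtain t where t: "simple_L1_approx M f t" "\<And>n x. x \<in> space M \<Longrightarrow> t n x \<in> insert 0 (f ` space M)"
    using simple_L1_approx_contraction[of f s f] by blast
  obtain J where J: "has_strong_bochner_integral M f J" "(\<lambda>n. simple_bochner_integral M (t n)) \<longlonglongrightarrow> J"
    using simple_L1_approx_imp_has_integral[OF t(1)] .
  have "0 \<le> t n x" if "x \<in> space M" for n x
    using t(2)[OF that, of n] nonneg by auto
  then have "0 \<le> simple_bochner_integral M (t n)" for n
    by (auto simp: simple_bochner_integral_def intro!: sum_nonneg scaleR_nonneg_nonneg)
  then have "0 \<le> J"
    using closed_sequentially[OF closed_nonneg, of "\<lambda>n. simple_bochner_integral M (t n)" J] J(2) by simp
  with has_strong_bochner_integral_unique[OF f J(1)] show ?thesis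
    by simp
qed

lemma has_strong_bochner_integral_mono:
  fixes f g :: "'a \<Rightarrow> 'e::ordered_banach"
  assumes "has_strong_bochner_integral M f I" "has_strong_bochner_integral M g J"
    and "\<And>x. x \<in> space M \<Longrightarrow> f x \<le> g x"
  shows "I \<le> J"
  using has_strong_bochner_integral_nonneg[OF has_strong_bochner_integral_diff[OF assms(2,1)]] assms(3)
  by simp

lemma strong_bochner_dominated_convergence:
  assumes f: "\<And>n. has_strong_bochner_integral M (f n) (I n)"
    and g: "has_strong_bochner_integral M g J" and h: "strong_bochner_integrable M h"
    and le: "\<And>n x. x \<in> space M \<Longrightarrow> norm (f n x - g x) \<le> norm (h x)"
    and lim: "AE x in M. (\<lambda>n. f n x) \<longlonglongrightarrow> g x"
  shows "I \<longlonglongrightarrow> J"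
proof -
  obtain u where u: "simple_L1_approx M h u"
    using h by (auto simp: strong_bochner_integrable_def has_strong_bochner_integral_iff_approx)
  have fg: "has_strong_bochner_integral M (\<lambda>x. f n x - g x) (I n - J)" for n
    using f g by (rule has_strong_bochner_integral_diff)
  have meas: "(\<lambda>x. norm (f n x - g x)) \<in> borel_measurable M" for n
    using fg[of n] simple_L1_approx_norm_measurable0
    by (auto simp: has_strong_bochner_integral_iff_approx)
  have "(\<lambda>n. \<integral>\<^sup>+x. norm (f n x - g x) \<partial>M) \<longlonglongrightarrow> (\<integral>\<^sup>+x. 0 \<partial>M)"
  proof (rule nn_integral_dominated_convergence[where w = "\<lambda>x. norm (h x)"])
    show "(\<integral>\<^sup>+x. norm (h x) \<partial>M) < \<infinity>"
      using u by (rule simple_L1_approx_nn_integral_finite)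
    show "AE x in M. (\<lambda>n. ennreal (norm (f n x - g x))) \<longlonglongrightarrow> 0"
      using lim
    proof eventually_elim
      case (elim x)
      then have "(\<lambda>n. norm (f n x - g x)) \<longlonglongrightarrow> 0"
        by (intro tendsto_norm_zero LIM_zero)
      then show ?case
        using tendsto_ennrealI by fastforce
    qed
  qed (use meas simple_L1_approx_norm_measurable0[OF u] le in \<open>auto intro!: AE_I2 ennreal_leI\<close>)
  then have lim0: "(\<lambda>n. \<integral>\<^sup>+x. norm (f n x - g x) \<partial>M) \<longlonglongrightarrow> 0"
    by simp
  have "(\<lambda>n. ennreal (norm (I n - J))) \<longlonglongrightarrow> ennreal 0"
    unfolding ennreal_0
  proof (rule tendsto_sandwich[OF _ _ tendsto_const lim0])
    show "\<forall>\<^sub>F n in sequentially. ennreal (norm (I n - J)) \<le> (\<integral>\<^sup>+x. norm (f n x - g x) \<partial>M)"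
      by (intro always_eventually allI norm_strong_bochner_integral_le fg)
  qed simp
  then have "(\<lambda>n. norm (I n - J)) \<longlonglongrightarrow> 0"
    by (subst (asm) tendsto_ennreal_iff) auto
  then show ?thesis
    by (intro LIM_zero_cancel[of I J]) (simp only: tendsto_norm_zero_iff)
qed

end

section \<open>Recurrence from the right\<close>

lemma complete_measure_lebesgue_on:
  assumes S: "S \<in> sets lebesgue"
  shows "complete_measure (lebesgue_on S)"
proof
  fix A B assume "B \<subseteq> A" "A \<in> null_sets (lebesgue_on S)"
  then have "B \<subseteq> S" "A \<in> null_sets lebesgue"
    using S by (auto simp: null_sets_restrict_space)
  then show "B \<in> sets (lebesgue_on S)"
    using S \<open>B \<subseteq> A\<close> completion.complete by (auto simp: sets_restrict_space_iff)
qed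

lemma countable_right_isolated:
  fixes E :: "real set"
  shows "countable {t\<in>E. \<exists>q>t. {t<..<q} \<inter> E = {}}"
proof -
  define I where "I = {t\<in>E. \<exists>q>t. {t<..<q} \<inter> E = {}}"
  have "\<exists>p\<in>\<rat>. t < p \<and> {t<..<p} \<inter> E = {}" if t: "t \<in> I" for t
  proof -
    obtain q where q: "t < q" "{t<..<q} \<inter> E = {}"
      using t by (auto simp: I_def)
    obtain p where "p \<in> \<rat>" "t < p" "p < q"
      using Rats_dense_in_real[OF q(1)] by blast
    moreover from this have "{t<..<p} \<subseteq> {t<..<q}"
      by auto
    ultimately show ?thesis
      using q(2) by blast
  qed
  then have "\<forall>t\<in>I. \<exists>p. p \<in> \<rat> \<and> t < p \<and> {t<..<p} \<inter> E = {}"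
    by blast
  from bchoice[OF this] obtain p where p: "\<forall>t\<in>I. p t \<in> \<rat> \<and> t < p t \<and> {t<..<p t} \<inter> E = {}"
    by blast
  have less: "p t < p t'" if t: "t \<in> I" "t' \<in> I" "t < t'" for t t'
  proof -
    have "t' \<in> E" "{t<..<p t} \<inter> E = {}"
      using t p by (auto simp: I_def)
    then have "t' \<notin> {t<..<p t}"
      by blast
    then have "p t \<le> t'"
      using t(3) by simp
    also have "t' < p t'"
      using p t(2) by blast
    finally show ?thesis .
  qed
  have "inj_on p I"
  proof (rule inj_onI)
    fix t t' assume "t \<in> I" "t' \<in> I" "p t = p t'"
    then show "t = t'"
      using less[of t t'] less[of t' t] by (cases t t' rule: linorder_cases) auto
  qed
  moreover have "p ` I \<subseteq> \<rat>"
    using p by blast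
  ultimately have "countable I"
    using countable_rat countable_subset countable_image_inj_on by blast
  then show ?thesis
    by (simp add: I_def)
qed

text \<open>A strongly measurable function has essentially separable range. So almost all of its domain
  is covered by countably many sets on each of which it oscillates by less than \<open>e\<close>.\<close>

lemma AE_right_recurrent:
  fixes G :: "real \<Rightarrow> 'b::real_normed_vector"
  assumes S: "S \<in> sets lebesgue" and G: "strong_bochner_integrable (lebesgue_on S) G"
  shows "AE t in lebesgue_on S. \<forall>e>0. \<exists>r>t. norm (G r - G t) < e"
proof -
  obtain s where s: "simple_L1_approx (lebesgue_on S) G s"
    using G by (auto simp: strong_bochner_integrable_def has_strong_bochner_integral_iff_approx)
  define E where "E v k = {t. norm (G t - v) < 1 / real (Suc k)}" for v k
  define B where "B = (\<Union>n. \<Union>v\<in>s n ` S. \<Union>k. {t\<in>E v k. \<exists>q>t. {t<..<q} \<inter> E v k = {}})"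
  have "countable (s n ` S)" for n
    using s simple_functionD(1)[OF simple_bochner_integrable_simple_function, of "lebesgue_on S" "s n"]
    by (simp add: simple_L1_approx_def countable_finite)
  then have "countable B"
    unfolding B_def by (intro countable_UN countable_right_isolated) auto
  then have "B \<in> null_sets lebesgue"
    by (intro null_sets_completionI countable_imp_null_set_lborel)
  then have "AE t in lebesgue_on S. t \<notin> B"
    using S by (subst AE_restrict_space_iff) (auto dest: AE_not_in)
  moreover have "AE t in lebesgue_on S. (\<lambda>n. s n t) \<longlonglongrightarrow> G t"
    using s by (simp add: simple_L1_approx_def)
  ultimately show ?thesis
    using AE_space
  proof eventually_elim
    case (elim t)
    show ?case
    proof (intro allI impI)
      fix e :: real assume "0 < e"
      then obtain k where k: "1 / real (Suc k) < e / 2"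
        using nat_approx_posE[of "e / 2"] by auto
      have "\<forall>\<^sub>F n in sequentially. dist (s n t) (G t) < 1 / real (Suc k)"
        using elim(2) by (rule tendstoD) simp
      then obtain n where "dist (s n t) (G t) < 1 / real (Suc k)"
        by (auto simp: eventually_sequentially)
      then have t: "t \<in> E (s n t) k"
        by (simp add: E_def dist_norm norm_minus_commute)
      have "{t<..<t + 1} \<inter> E (s n t) k \<noteq> {}"
      proof
        assume "{t<..<t + 1} \<inter> E (s n t) k = {}"
        then have "t \<in> {t\<in>E (s n t) k. \<exists>q>t. {t<..<q} \<inter> E (s n t) k = {}}"
          using t by (auto intro!: exI[of _ "t + 1"])
        then have "t \<in> B"
          using elim(3) unfolding B_def by auto
        with elim(1) show False ..
      qed
      then obtain r where r: "t < r" "r \<in> E (s n t) k"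
        by auto
      have "norm (G r - G t) \<le> norm (G r - s n t) + norm (G t - s n t)"
        using norm_triangle_ineq4[of "G r - s n t" "G t - s n t"] by simp
      also have "\<dots> < e"
        using r(2) t k by (simp add: E_def)
      finally show "\<exists>r>t. norm (G r - G t) < e"
        using r(1) by blast
    qed
  qed
qed

lemma norm_diff_mono:
  fixes a b c :: "'e::ordered_banach"
  assumes "a \<le> b" "b \<le> c"
  shows "norm (c - b) \<le> norm (c - a)" "norm (b - a) \<le> norm (c - a)"
  using assms by (auto intro!: norm_mono diff_left_mono diff_right_mono)

section \<open>Continuity and submodularity of the Choquet-Bochner integral\<close>

locale vector_capacity_on_lattice =
  fixes X :: "'a set" and \<Sigma> :: "'a set set" and \<mu> :: "'a set \<Rightarrow> 'e::ordered_banach"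
  assumes lattice: "lattice_of_sets X \<Sigma>" and capacity: "vector_capacity \<Sigma> \<mu>"
begin

lemma capacity_nonneg: "A \<in> \<Sigma> \<Longrightarrow> 0 \<le> \<mu> A"
  and capacity_mono: "A \<in> \<Sigma> \<Longrightarrow> B \<in> \<Sigma> \<Longrightarrow> A \<subseteq> B \<Longrightarrow> \<mu> A \<le> \<mu> B"
  using capacity by (auto simp: vector_capacity_def)

lemma sets_Un: "A \<in> \<Sigma> \<Longrightarrow> B \<in> \<Sigma> \<Longrightarrow> A \<union> B \<in> \<Sigma>"
  and sets_Int: "A \<in> \<Sigma> \<Longrightarrow> B \<in> \<Sigma> \<Longrightarrow> A \<inter> B \<in> \<Sigma>"
  and sets_subset: "A \<in> \<Sigma> \<Longrightarrow> A \<subseteq> X"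
  using lattice by (auto simp: lattice_of_sets_def)

lemma superlevel_in_sets:
  assumes "cb_integrable X \<Sigma> \<mu> f" "A \<in> \<Sigma>"
  shows "{x\<in>A. t \<le> f x} \<in> \<Sigma>"
proof -
  have "{x\<in>A. t \<le> f x} = A \<inter> {x\<in>X. t \<le> f x}"
    using sets_subset assms(2) by auto
  then show ?thesis
    using assms sets_Int by (simp add: cb_integrable_def cb_measurable_def)
qed

lemma cb_integrable_halves:
  assumes "cb_integrable X \<Sigma> \<mu> f" "A \<in> \<Sigma>"
  shows "strong_bochner_integrable (lebesgue_on {0..}) (\<lambda>t. \<mu> {x\<in>A. t \<le> f x})"
    "strong_bochner_integrable (lebesgue_on {..0}) (\<lambda>t. \<mu> {x\<in>A. t \<le> f x} - \<mu> A)"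
  using assms by (auto simp: cb_integrable_def)

sublocale pos: complete_measure "lebesgue_on {0::real..}"
  by (rule complete_measure_lebesgue_on) simp

sublocale neg: complete_measure "lebesgue_on {..0::real}"
  by (rule complete_measure_lebesgue_on) simp

lemma has_integral_halves:
  assumes "cb_integrable X \<Sigma> \<mu> f" "A \<in> \<Sigma>"
  shows "has_strong_bochner_integral (lebesgue_on {0..}) (\<lambda>t. \<mu> {x\<in>A. t \<le> f x})
      (strong_bochner_integral (lebesgue_on {0..}) (\<lambda>t. \<mu> {x\<in>A. t \<le> f x}))"
    "has_strong_bochner_integral (lebesgue_on {..0}) (\<lambda>t. \<mu> {x\<in>A. t \<le> f x} - \<mu> A)
      (strong_bochner_integral (lebesgue_on {..0}) (\<lambda>t. \<mu> {x\<in>A. t \<le> f x} - \<mu> A))"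
  using assms by (rule pos.has_strong_bochner_integral_integral[OF cb_integrable_halves(1)]
      neg.has_strong_bochner_integral_integral[OF cb_integrable_halves(2)])+

lemma lower_continuousD:
  assumes "lower_continuous \<Sigma> \<mu>" "\<And>n. B n \<in> \<Sigma>" "incseq B" "(\<Union>n. B n) = C" "C \<in> \<Sigma>"
  shows "(\<lambda>n. \<mu> (B n)) \<longlonglongrightarrow> \<mu> C"
proof -
  have "range B \<subseteq> \<Sigma> \<and> incseq B \<and> (\<Union>n. B n) \<in> \<Sigma>"
    using assms by auto
  then show ?thesis
    using assms(1) unfolding lower_continuous_def assms(4)[symmetric] by blast
qed

lemma upper_continuousD:
  assumes "upper_continuous \<Sigma> \<mu>" "\<And>n. B n \<in> \<Sigma>" "decseq B" "(\<Inter>n. B n) = C" "C \<in> \<Sigma>"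
  shows "(\<lambda>n. \<mu> (B n)) \<longlonglongrightarrow> \<mu> C"
proof -
  have "range B \<subseteq> \<Sigma> \<and> decseq B \<and> (\<Inter>n. B n) \<in> \<Sigma>"
    using assms by auto
  then show ?thesis
    using assms(1) unfolding upper_continuous_def assms(4)[symmetric] by blast
qed

lemma cb_integral_dominated_convergence:
  assumes f: "\<And>n. cb_integrable X \<Sigma> \<mu> (f n)" and g: "cb_integrable X \<Sigma> \<mu> g" and A: "A \<in> \<Sigma>"
    and h: "strong_bochner_integrable (lebesgue_on {0..}) h" "strong_bochner_integrable (lebesgue_on {..0}) k"
    and le: "\<And>n t. norm (\<mu> {x\<in>A. t \<le> f n x} - \<mu> {x\<in>A. t \<le> g x}) \<le> norm (h t)"
      "\<And>n t. norm (\<mu> {x\<in>A. t \<le> f n x} - \<mu> {x\<in>A. t \<le> g x}) \<le> norm (k t)"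
    and lim: "AE t in lebesgue_on {0..}. (\<lambda>n. \<mu> {x\<in>A. t \<le> f n x}) \<longlonglongrightarrow> \<mu> {x\<in>A. t \<le> g x}"
      "AE t in lebesgue_on {..0}. (\<lambda>n. \<mu> {x\<in>A. t \<le> f n x}) \<longlonglongrightarrow> \<mu> {x\<in>A. t \<le> g x}"
  shows "(\<lambda>n. norm (cb_integral \<mu> A (f n) - cb_integral \<mu> A g)) \<longlonglongrightarrow> 0"
proof -
  note pos.strong_bochner_dominated_convergence
    [OF has_integral_halves(1)[OF f A] has_integral_halves(1)[OF g A] h(1) le(1) lim(1)]
  moreover have "(\<lambda>n. strong_bochner_integral (lebesgue_on {..0}) (\<lambda>t. \<mu> {x\<in>A. t \<le> f n x} - \<mu> A))
    \<longlonglongrightarrow> strong_bochner_integral (lebesgue_on {..0}) (\<lambda>t. \<mu> {x\<in>A. t \<le> g x} - \<mu> A)"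
  proof (rule neg.strong_bochner_dominated_convergence
      [OF has_integral_halves(2)[OF f A] has_integral_halves(2)[OF g A] h(2)])
    show "AE t in lebesgue_on {..0}. (\<lambda>n. \<mu> {x\<in>A. t \<le> f n x} - \<mu> A) \<longlonglongrightarrow> \<mu> {x\<in>A. t \<le> g x} - \<mu> A"
      using lim(2) by eventually_elim (intro tendsto_diff tendsto_const)
  qed (use le(2) in simp)
  ultimately have "(\<lambda>n. cb_integral \<mu> A (f n)) \<longlonglongrightarrow> cb_integral \<mu> A g"
    unfolding cb_integral_def by (rule tendsto_add)
  then show ?thesis
    by (intro tendsto_norm_zero LIM_zero)
qed

lemma cb_integral_upper_continuous:
  assumes upper: "upper_continuous \<Sigma> \<mu>"
    and f: "\<And>n. cb_integrable X \<Sigma> \<mu> (f n)" and g: "cb_integrable X \<Sigma> \<mu> g" and A: "A \<in> \<Sigma>"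
    and dec: "\<And>x. x \<in> X \<Longrightarrow> decseq (\<lambda>n. f n x)" and lim: "\<And>x. x \<in> X \<Longrightarrow> (\<lambda>n. f n x) \<longlonglongrightarrow> g x"
  shows "(\<lambda>n. norm (cb_integral \<mu> A (f n) - cb_integral \<mu> A g)) \<longlonglongrightarrow> 0"
proof -
  let ?F = "\<lambda>n t. {x\<in>A. t \<le> f n x}" and ?G = "\<lambda>t. {x\<in>A. t \<le> g x}"
  have F: "?F n t \<in> \<Sigma>" and G: "?G t \<in> \<Sigma>" for n t
    using superlevel_in_sets f g A by auto
  have AX: "x \<in> X" if "x \<in> A" for x
    using sets_subset[OF A] that by auto
  have g_le: "g x \<le> f n x" if "x \<in> A" for n x
    using dec lim AX[OF that] by (intro decseq_ge)
  have sub: "?G t \<subseteq> ?F n t" "?F n t \<subseteq> ?F 0 t" for n t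
    using g_le decseqD[OF dec[OF AX], of _ 0 n] by (auto intro: order_trans)
  have conv: "(\<lambda>n. \<mu> (?F n t)) \<longlonglongrightarrow> \<mu> (?G t)" for t
  proof (rule upper_continuousD[OF upper F _ _ G])
      show "decseq (\<lambda>n. ?F n t)"
        using decseqD[OF dec[OF AX]] by (auto simp: decseq_def intro: order_trans)
      show "(\<Inter>n. ?F n t) = ?G t"
      proof
        show "(\<Inter>n. ?F n t) \<subseteq> ?G t"
          using LIMSEQ_le_const[OF lim[OF AX]] by auto
        show "?G t \<subseteq> (\<Inter>n. ?F n t)"
          using sub(1) by blast
      qed
    qed
  show ?thesis
  proof (rule cb_integral_dominated_convergence[OF f g A
        cb_integrable_halves(1)[OF f[of 0] A] cb_integrable_halves(2)[OF g A]])
    fix n t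
    have "\<mu> (?G t) \<le> \<mu> (?F n t)" "\<mu> (?F n t) \<le> \<mu> (?F 0 t)" "\<mu> (?F n t) \<le> \<mu> A" "0 \<le> \<mu> (?G t)"
      using capacity_mono[OF G F sub(1)] capacity_mono[OF F F sub(2)] capacity_mono[OF F A Collect_restrict]
        capacity_nonneg[OF G] by auto
    then show "norm (\<mu> (?F n t) - \<mu> (?G t)) \<le> norm (\<mu> (?F 0 t))"
      "norm (\<mu> (?F n t) - \<mu> (?G t)) \<le> norm (\<mu> (?G t) - \<mu> A)"
      using norm_mono[of "\<mu> (?F n t) - \<mu> (?G t)" "\<mu> (?F 0 t)"] norm_diff_mono(2)[of "\<mu> (?G t)" "\<mu> (?F n t)" "\<mu> A"]
      by (auto simp: norm_minus_commute diff_le_eq add_increasing2)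
  qed (use conv in auto)
qed

text \<open>The union of the sets \<open>{f n \<ge> t}\<close> may fail to lie in \<open>\<Sigma>\<close>. Intersecting them with
  \<open>{g \<ge> r}\<close> for some \<open>r > t\<close> repairs this: the union becomes \<open>{g \<ge> r}\<close>.\<close>

lemma superlevel_lower_limit:
  assumes lower: "lower_continuous \<Sigma> \<mu>"
    and f: "\<And>n. cb_integrable X \<Sigma> \<mu> (f n)" and g: "cb_integrable X \<Sigma> \<mu> g" and A: "A \<in> \<Sigma>"
    and inc: "\<And>x. x \<in> X \<Longrightarrow> incseq (\<lambda>n. f n x)" and lim: "\<And>x. x \<in> X \<Longrightarrow> (\<lambda>n. f n x) \<longlonglongrightarrow> g x"
    and right: "\<forall>e>0. \<exists>r>t. norm (\<mu> {x\<in>A. r \<le> g x} - \<mu> {x\<in>A. t \<le> g x}) < e"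
  shows "(\<lambda>n. \<mu> {x\<in>A. t \<le> f n x}) \<longlonglongrightarrow> \<mu> {x\<in>A. t \<le> g x}"
proof (rule tendstoI)
  fix e :: real assume "0 < e"
  let ?F = "\<lambda>n. {x\<in>A. t \<le> f n x}" and ?G = "\<lambda>t. {x\<in>A. t \<le> g x}"
  have F: "?F n \<in> \<Sigma>" and G: "?G t \<in> \<Sigma>" for n t
    using superlevel_in_sets f g A by auto
  have AX: "x \<in> X" if "x \<in> A" for x
    using sets_subset[OF A] that by auto
  obtain r where r: "t < r" "norm (\<mu> (?G r) - \<mu> (?G t)) < e / 2"
    using right \<open>0 < e\<close> by (meson half_gt_zero)
  have B: "?F n \<inter> ?G r \<in> \<Sigma>" for n
    using F G by (rule sets_Int)
  have "(\<lambda>n. \<mu> (?F n \<inter> ?G r)) \<longlonglongrightarrow> \<mu> (?G r)"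
  proof (rule lower_continuousD[OF lower B _ _ G])
    show "incseq (\<lambda>n. ?F n \<inter> ?G r)"
      using incseqD[OF inc[OF AX]] by (auto simp: incseq_def intro: order_trans)
    show "(\<Union>n. ?F n \<inter> ?G r) = ?G r"
    proof (intro equalityI subsetI)
      fix x assume x: "x \<in> ?G r"
      then have "\<forall>\<^sub>F n in sequentially. t < f n x"
        using r(1) by (intro order_tendstoD(1)[OF lim[OF AX]]) auto
      then show "x \<in> (\<Union>n. ?F n \<inter> ?G r)"
        using x by (auto simp: eventually_sequentially intro: less_imp_le)
    qed auto
  qed
  then have "\<forall>\<^sub>F n in sequentially. dist (\<mu> (?F n \<inter> ?G r)) (\<mu> (?G r)) < e / 2"
    using \<open>0 < e\<close> by (intro tendstoD) auto
  then show "\<forall>\<^sub>F n in sequentially. dist (\<mu> (?F n)) (\<mu> (?G t)) < e"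
  proof eventually_elim
    case (elim n)
    have "f n x \<le> g x" if "x \<in> A" for x
      using inc lim AX[OF that] by (intro incseq_le)
    then have "\<mu> (?F n \<inter> ?G r) \<le> \<mu> (?F n)" "\<mu> (?F n) \<le> \<mu> (?G t)"
      using F G B by (auto intro!: capacity_mono intro: order_trans)
    then have "norm (\<mu> (?G t) - \<mu> (?F n)) \<le> norm (\<mu> (?G t) - \<mu> (?F n \<inter> ?G r))"
      by (rule norm_diff_mono(1))
    also have "\<dots> \<le> norm (\<mu> (?G t) - \<mu> (?G r)) + norm (\<mu> (?F n \<inter> ?G r) - \<mu> (?G r))"
      using norm_triangle_ineq4[of "\<mu> (?G t) - \<mu> (?G r)" "\<mu> (?F n \<inter> ?G r) - \<mu> (?G r)"] by simp
    also have "\<dots> < e"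
      using elim r(2) by (simp add: dist_norm norm_minus_commute)
    finally show ?case
      by (simp add: dist_norm norm_minus_commute)
  qed
qed

lemma cb_integral_lower_continuous:
  assumes lower: "lower_continuous \<Sigma> \<mu>"
    and f: "\<And>n. cb_integrable X \<Sigma> \<mu> (f n)" and g: "cb_integrable X \<Sigma> \<mu> g" and A: "A \<in> \<Sigma>"
    and inc: "\<And>x. x \<in> X \<Longrightarrow> incseq (\<lambda>n. f n x)" and lim: "\<And>x. x \<in> X \<Longrightarrow> (\<lambda>n. f n x) \<longlonglongrightarrow> g x"
  shows "(\<lambda>n. norm (cb_integral \<mu> A (f n) - cb_integral \<mu> A g)) \<longlonglongrightarrow> 0"
proof -
  let ?F = "\<lambda>n t. {x\<in>A. t \<le> f n x}" and ?G = "\<lambda>t. {x\<in>A. t \<le> g x}"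
  have F: "?F n t \<in> \<Sigma>" and G: "?G t \<in> \<Sigma>" for n t
    using superlevel_in_sets f g A by auto
  have AX: "x \<in> X" if "x \<in> A" for x
    using sets_subset[OF A] that by auto
  have g_ge: "f n x \<le> g x" if "x \<in> A" for n x
    using inc lim AX[OF that] by (intro incseq_le)
  have sub: "?F n t \<subseteq> ?G t" "?F 0 t \<subseteq> ?F n t" for n t
    using g_ge incseqD[OF inc[OF AX], of _ 0 n] by (auto intro: order_trans)
  note conv = superlevel_lower_limit[OF lower f g A inc lim]
  show ?thesis
  proof (rule cb_integral_dominated_convergence[OF f g A
        cb_integrable_halves(1)[OF g A] cb_integrable_halves(2)[OF f[of 0] A]])
    fix n t
    have "\<mu> (?F n t) \<le> \<mu> (?G t)" "\<mu> (?F 0 t) \<le> \<mu> (?F n t)" "\<mu> (?G t) \<le> \<mu> A" "0 \<le> \<mu> (?F n t)"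
      using capacity_mono[OF F G sub(1)] capacity_mono[OF F F sub(2)] capacity_mono[OF G A Collect_restrict]
        capacity_nonneg[OF F] by auto
    moreover from this have "norm (\<mu> (?G t) - \<mu> (?F n t)) \<le> norm (\<mu> A - \<mu> (?F 0 t))"
      by (intro norm_mono diff_mono) auto
    ultimately show "norm (\<mu> (?F n t) - \<mu> (?G t)) \<le> norm (\<mu> (?G t))"
      "norm (\<mu> (?F n t) - \<mu> (?G t)) \<le> norm (\<mu> (?F 0 t) - \<mu> A)"
      using norm_mono[of "\<mu> (?G t) - \<mu> (?F n t)" "\<mu> (?G t)"]
      by (auto simp: norm_minus_commute)
  next
    show "AE t in lebesgue_on {0..}. (\<lambda>n. \<mu> (?F n t)) \<longlonglongrightarrow> \<mu> (?G t)"
      using AE_right_recurrent[OF _ cb_integrable_halves(1)[OF g A]] by (auto intro: conv)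
    have "AE t in lebesgue_on {..0}. \<forall>e>0. \<exists>r>t. norm ((\<mu> (?G r) - \<mu> A) - (\<mu> (?G t) - \<mu> A)) < e"
      by (rule AE_right_recurrent[OF _ cb_integrable_halves(2)[OF g A]]) simp
    then show "AE t in lebesgue_on {..0}. (\<lambda>n. \<mu> (?F n t)) \<longlonglongrightarrow> \<mu> (?G t)"
      by (auto intro: conv)
  qed
qed

text \<open>By submodularity the increments of \<open>t \<mapsto> \<mu> {max f g \<ge> t}\<close> are dominated by those of
  \<open>t \<mapsto> \<mu> {f \<ge> t} + \<mu> {g \<ge> t}\<close>, so the former is the image of the latter under a contraction;
  this is what makes it strongly measurable.\<close>

lemma submodular_Un_increment:
  assumes sub: "submodular \<Sigma> \<mu>"
    and sets: "P \<in> \<Sigma>" "P' \<in> \<Sigma>" "Q \<in> \<Sigma>" "Q' \<in> \<Sigma>" and PQ: "P' \<subseteq> P" "Q' \<subseteq> Q"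
  shows "\<mu> (P \<union> Q) - \<mu> (P' \<union> Q') \<le> (\<mu> P + \<mu> Q) - (\<mu> P' + \<mu> Q')"
proof -
  have *: "\<mu> (C \<union> D) - \<mu> (C' \<union> D) \<le> \<mu> C - \<mu> C'"
    if "C \<in> \<Sigma>" "C' \<in> \<Sigma>" "D \<in> \<Sigma>" "C' \<subseteq> C" for C C' D
  proof -
    have "\<mu> (C \<union> (C' \<union> D)) + \<mu> (C \<inter> (C' \<union> D)) \<le> \<mu> C + \<mu> (C' \<union> D)"
      using sub that sets_Un by (simp add: submodular_def)
    moreover have "\<mu> C' \<le> \<mu> (C \<inter> (C' \<union> D))"
      using that by (intro capacity_mono sets_Int sets_Un) auto
    moreover have "C \<union> (C' \<union> D) = C \<union> D"
      using that by auto
    ultimately have "\<mu> (C \<union> D) + \<mu> C' \<le> \<mu> C + \<mu> (C' \<union> D)"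
      by (metis add_left_mono order_trans)
    then show ?thesis
      by (simp add: algebra_simps)
  qed
  have "\<mu> (P \<union> Q) - \<mu> (P' \<union> Q') = (\<mu> (P \<union> Q) - \<mu> (P' \<union> Q)) + (\<mu> (Q \<union> P') - \<mu> (Q' \<union> P'))"
    by (simp add: Un_commute)
  also have "\<dots> \<le> (\<mu> P - \<mu> P') + (\<mu> Q - \<mu> Q')"
    using sets PQ by (intro add_mono *)
  finally show ?thesis
    by (simp add: algebra_simps)
qed

lemma cb_integrable_max:
  assumes sub: "submodular \<Sigma> \<mu>" and f: "cb_integrable X \<Sigma> \<mu> f" and g: "cb_integrable X \<Sigma> \<mu> g"
  shows "cb_integrable X \<Sigma> \<mu> (\<lambda>x. max (f x) (g x))"
  unfolding cb_integrable_def
proof (intro conjI ballI)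
  have "{x\<in>X. t \<le> max (f x) (g x)} = {x\<in>X. t \<le> f x} \<union> {x\<in>X. t \<le> g x}" for t
    by (auto simp: le_max_iff_disj)
  then show "cb_measurable X \<Sigma> (\<lambda>x. max (f x) (g x))"
    using f g sets_Un by (simp add: cb_measurable_def cb_integrable_def)
next
  fix A assume A: "A \<in> \<Sigma>"
  let ?F = "\<lambda>t. {x\<in>A. t \<le> f x}" and ?G = "\<lambda>t. {x\<in>A. t \<le> g x}"
  have F: "?F t \<in> \<Sigma>" and G: "?G t \<in> \<Sigma>" for t
    using superlevel_in_sets f g A by auto
  have max: "{x\<in>A. t \<le> max (f x) (g x)} = ?F t \<union> ?G t" for t
    by (auto simp: le_max_iff_disj)
  have incr: "norm (\<mu> (?F t \<union> ?G t) - \<mu> (?F t' \<union> ?G t')) \<le>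
      norm ((\<mu> (?F t) + \<mu> (?G t)) - (\<mu> (?F t') + \<mu> (?G t')))" if "t \<le> t'" for t t'
  proof (rule norm_mono)
    show "0 \<le> \<mu> (?F t \<union> ?G t) - \<mu> (?F t' \<union> ?G t')"
      using that F G by (auto intro!: capacity_mono sets_Un)
    show "\<mu> (?F t \<union> ?G t) - \<mu> (?F t' \<union> ?G t') \<le> (\<mu> (?F t) + \<mu> (?G t)) - (\<mu> (?F t') + \<mu> (?G t'))"
      using that by (intro submodular_Un_increment[OF sub F F G G]) auto
  qed
  have contr: "norm (\<mu> (?F t \<union> ?G t) - \<mu> (?F t' \<union> ?G t')) \<le>
      norm ((\<mu> (?F t) + \<mu> (?G t)) - (\<mu> (?F t') + \<mu> (?G t')))" for t t'
    using incr[of t t'] incr[of t' t] by (cases "t \<le> t'") (auto simp: norm_minus_commute)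
  have "strong_bochner_integrable (lebesgue_on {0..}) (\<lambda>t. \<mu> (?F t \<union> ?G t))"
  proof (rule pos.strong_bochner_integrable_contraction)
    show "strong_bochner_integrable (lebesgue_on {0..}) (\<lambda>t. \<mu> (?F t) + \<mu> (?G t))"
      using pos.has_strong_bochner_integral_add[OF has_integral_halves(1)[OF f A] has_integral_halves(1)[OF g A]]
      by (auto simp: strong_bochner_integrable_def)
    fix t
    have "\<mu> (?F t \<union> ?G t) + \<mu> (?F t \<inter> ?G t) \<le> \<mu> (?F t) + \<mu> (?G t)"
      using sub F G by (simp add: submodular_def)
    moreover have "0 \<le> \<mu> (?F t \<inter> ?G t)" "0 \<le> \<mu> (?F t \<union> ?G t)"
      using F G by (auto intro!: capacity_nonneg sets_Int sets_Un)
    ultimately show "norm (\<mu> (?F t \<union> ?G t)) \<le> norm (\<mu> (?F t) + \<mu> (?G t))"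
      by (intro norm_mono) (auto intro: order_trans[OF add_increasing2])
  qed (rule contr)
  then show "strong_bochner_integrable (lebesgue_on {0..}) (\<lambda>t. \<mu> {x\<in>A. t \<le> max (f x) (g x)})"
    by (simp add: max)
  have "strong_bochner_integrable (lebesgue_on {..0}) (\<lambda>t. \<mu> (?F t \<union> ?G t) - \<mu> A)"
  proof (rule neg.strong_bochner_integrable_contraction)
    show "strong_bochner_integrable (lebesgue_on {..0}) (\<lambda>t. (\<mu> (?F t) - \<mu> A) + (\<mu> (?G t) - \<mu> A))"
      using neg.has_strong_bochner_integral_add[OF has_integral_halves(2)[OF f A] has_integral_halves(2)[OF g A]]
      by (auto simp: strong_bochner_integrable_def)
    fix t
    have "\<mu> (?F t) \<le> \<mu> (?F t \<union> ?G t)" "\<mu> (?F t \<union> ?G t) \<le> \<mu> A" "\<mu> (?G t) \<le> \<mu> A"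
      using F G A by (auto intro!: capacity_mono sets_Un)
    then have "norm (\<mu> A - \<mu> (?F t \<union> ?G t)) \<le> norm ((\<mu> A - \<mu> (?F t)) + (\<mu> A - \<mu> (?G t)))"
      by (intro norm_mono add_increasing2 diff_left_mono) auto
    also have "(\<mu> A - \<mu> (?F t)) + (\<mu> A - \<mu> (?G t)) = - ((\<mu> (?F t) - \<mu> A) + (\<mu> (?G t) - \<mu> A))"
      by simp
    finally show "norm (\<mu> (?F t \<union> ?G t) - \<mu> A) \<le> norm ((\<mu> (?F t) - \<mu> A) + (\<mu> (?G t) - \<mu> A))"
      by (simp only: norm_minus_cancel norm_minus_commute)
  next
    fix t t'
    show "norm ((\<mu> (?F t \<union> ?G t) - \<mu> A) - (\<mu> (?F t' \<union> ?G t') - \<mu> A)) \<le>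
      norm ((\<mu> (?F t) - \<mu> A) + (\<mu> (?G t) - \<mu> A) - ((\<mu> (?F t') - \<mu> A) + (\<mu> (?G t') - \<mu> A)))"
      using contr[of t t'] by (simp add: algebra_simps)
  qed
  then show "strong_bochner_integrable (lebesgue_on {..0}) (\<lambda>t. \<mu> {x\<in>A. t \<le> max (f x) (g x)} - \<mu> A)"
    by (simp add: max)
qed

lemma cb_integral_submodular:
  assumes sub: "submodular \<Sigma> \<mu>" and f: "cb_integrable X \<Sigma> \<mu> f" and g: "cb_integrable X \<Sigma> \<mu> g"
    and min: "cb_integrable X \<Sigma> \<mu> (\<lambda>x. min (f x) (g x))" and A: "A \<in> \<Sigma>"
  shows "cb_integral \<mu> A (\<lambda>x. max (f x) (g x)) + cb_integral \<mu> A (\<lambda>x. min (f x) (g x))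
    \<le> cb_integral \<mu> A f + cb_integral \<mu> A g"
proof -
  note max = cb_integrable_max[OF sub f g]
  note f' = has_integral_halves[OF f A] and g' = has_integral_halves[OF g A]
    and max' = has_integral_halves[OF max A] and min' = has_integral_halves[OF min A]
  have le: "\<mu> {x\<in>A. t \<le> max (f x) (g x)} + \<mu> {x\<in>A. t \<le> min (f x) (g x)}
      \<le> \<mu> {x\<in>A. t \<le> f x} + \<mu> {x\<in>A. t \<le> g x}" for t
  proof -
    have "{x\<in>A. t \<le> max (f x) (g x)} = {x\<in>A. t \<le> f x} \<union> {x\<in>A. t \<le> g x}"
      "{x\<in>A. t \<le> min (f x) (g x)} = {x\<in>A. t \<le> f x} \<inter> {x\<in>A. t \<le> g x}"
      by (auto simp: le_max_iff_disj)
    then show ?thesis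
      using sub superlevel_in_sets[OF f A] superlevel_in_sets[OF g A] by (simp add: submodular_def)
  qed
  have le': "(\<mu> {x\<in>A. t \<le> max (f x) (g x)} - \<mu> A) + (\<mu> {x\<in>A. t \<le> min (f x) (g x)} - \<mu> A)
      \<le> (\<mu> {x\<in>A. t \<le> f x} - \<mu> A) + (\<mu> {x\<in>A. t \<le> g x} - \<mu> A)" for t
    using diff_right_mono[OF le, of t "\<mu> A + \<mu> A"] by (simp add: algebra_simps)
  note add_mono
    [OF pos.has_strong_bochner_integral_mono[OF
        pos.has_strong_bochner_integral_add[OF max'(1) min'(1)]
        pos.has_strong_bochner_integral_add[OF f'(1) g'(1)] le]
      neg.has_strong_bochner_integral_mono[OF
        neg.has_strong_bochner_integral_add[OF max'(2) min'(2)]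
        neg.has_strong_bochner_integral_add[OF f'(2) g'(2)] le']]
  then show ?thesis
    unfolding cb_integral_def by (simp only: add.assoc add.commute add.left_commute)
qed

end

theorem theorem1:
  fixes X :: "'a set" and \<Sigma> :: "'a set set"
    and \<mu> :: "'a set \<Rightarrow> 'e::regularly_ordered_banach"
  assumes "X \<noteq> {}" and "lattice_of_sets X \<Sigma>" and "vector_capacity \<Sigma> \<mu>"
  shows "(upper_continuous \<Sigma> \<mu> \<longrightarrow>
           (\<forall>(f :: nat \<Rightarrow> 'a \<Rightarrow> real) g. \<forall>A\<in>\<Sigma>.
              (\<forall>n. cb_integrable X \<Sigma> \<mu> (f n)) \<and> cb_integrable X \<Sigma> \<mu> g \<and>
              (\<forall>x\<in>X. decseq (\<lambda>n. f n x)) \<and> (\<forall>x\<in>X. (\<lambda>n. f n x) \<longlonglongrightarrow> g x) \<longrightarrow>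
              (\<lambda>n. norm (cb_integral \<mu> A (f n) - cb_integral \<mu> A g)) \<longlonglongrightarrow> 0))
       \<and> (lower_continuous \<Sigma> \<mu> \<longrightarrow>
           (\<forall>(f :: nat \<Rightarrow> 'a \<Rightarrow> real) g. \<forall>A\<in>\<Sigma>.
              (\<forall>n. cb_integrable X \<Sigma> \<mu> (f n)) \<and> cb_integrable X \<Sigma> \<mu> g \<and>
              (\<forall>x\<in>X. incseq (\<lambda>n. f n x)) \<and> (\<forall>x\<in>X. (\<lambda>n. f n x) \<longlonglongrightarrow> g x) \<longrightarrow>
              (\<lambda>n. norm (cb_integral \<mu> A (f n) - cb_integral \<mu> A g)) \<longlonglongrightarrow> 0))
       \<and> (algebra X \<Sigma> \<and> submodular \<Sigma> \<mu> \<longrightarrow>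
           (\<forall>(f :: 'a \<Rightarrow> real) g. \<forall>A\<in>\<Sigma>.
              cb_integrable X \<Sigma> \<mu> f \<and> cb_integrable X \<Sigma> \<mu> g \<and>
              cb_integrable X \<Sigma> \<mu> (\<lambda>x. min (f x) (g x)) \<longrightarrow>
              cb_integrable X \<Sigma> \<mu> (\<lambda>x. max (f x) (g x)) \<and>
              cb_integral \<mu> A (\<lambda>x. max (f x) (g x)) + cb_integral \<mu> A (\<lambda>x. min (f x) (g x))
                \<le> cb_integral \<mu> A f + cb_integral \<mu> A g))"
proof -
  interpret vector_capacity_on_lattice X \<Sigma> \<mu>
    using assms(2,3) by unfold_locales
  show ?thesis
    by (auto intro: cb_integral_upper_continuous cb_integral_lower_continuous
        cb_integrable_max cb_integral_submodular)
qed

end
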